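(* Let $\Omega\subseteq\mathbb{R}^d$ be a bounded convex domain which is symmetric with respect to $0$, and suppose that $\Omega$ is a translational tile. Then $\Omega$ is a Turán domain.
   Context: A domain is a nonempty open connected subset of $\mathbb{R}^d$; $\Omega$ is symmetric if $\Omega=-\Omega$. $|\Omega|$ denotes Lebesgue measure, and $\widehat{f}(\xi)=\int_{\mathbb{R}^d} f(x)e^{-2\pi i\langle \xi,x\rangle}\,dx$ is the Fourier transform. Translational tiles. A measurable set $\Omega\subseteq\mathbb{R}^d$ is a translational tile if there exists a set $\Lambda\subseteq\mathbb{R}^d$ such that almost every point (in the sense of Lebesgue measure) of $\mathbb{R}^d$ belongs to exactly one of the translates $\Omega+\lambda$, $\lambda\in\Lambda$. Turán domains. A positive definite function here means a continuous integrable function $f:\mathbb{R}^d\to\mathbb{C}$ whose Fourier transform is nonnegative, $\widehat f\ge 0$; it is supported in $\Omega$ if it vanishes outside $\Omega$. A symmetric convex domain $\Omega$ is called a Turán domain if the maximum of $\int_{\mathbb{R}^d} f$ over all positive definite functions $f$ supported in $\Omega$ with $f(0)=1$ is achieved by the function $$f=\frac{2^d}{|\Omega|}\,\chi_{\frac12\Omega}*\chi_{\frac12\Omega},$$ whose integral is $2^{-d}|\Omega|$. Here $\chi_E$ is the indicator function of $E$ and $*$ is convolution. Equivalently, $\int f\le 2^{-d}|\Omega|$ for every such $f$. *)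

theory Defs
  imports "HOL-Analysis.Analysis"
begin

definition is_domain :: "(real ^ 'd) set \<Rightarrow> bool" where
  "is_domain S \<longleftrightarrow> S \<noteq> {} \<and> open S \<and> connected S"

definition symmetric_set :: "(real ^ 'd) set \<Rightarrow> bool" where
  "symmetric_set S \<longleftrightarrow> uminus ` S = S"

definition translational_tile :: "(real ^ 'd) set \<Rightarrow> bool" where
  "translational_tile S \<longleftrightarrow>
     S \<in> sets lebesgue \<and>
     (\<exists>L. AE x in lebesgue. \<exists>!l. l \<in> L \<and> x \<in> (\<lambda>y. y + l) ` S)"

definition fourier :: "(real ^ 'd \<Rightarrow> complex) \<Rightarrow> real ^ 'd \<Rightarrow> complex" where
  "fourier f \<xi> =
     (LINT x|lebesgue. f x * exp (- (2 * of_real pi * \<i> * of_real (\<xi> \<bullet> x))))"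

definition convolution ::
    "(real ^ 'd \<Rightarrow> complex) \<Rightarrow> (real ^ 'd \<Rightarrow> complex) \<Rightarrow> real ^ 'd \<Rightarrow> complex" where
  "convolution f g x = (LINT y|lebesgue. f y * g (x - y))"

definition positive_definite :: "(real ^ 'd \<Rightarrow> complex) \<Rightarrow> bool" where
  "positive_definite f \<longleftrightarrow>
     continuous_on UNIV f \<and> integrable lebesgue f \<and>
     (\<forall>\<xi>. Im (fourier f \<xi>) = 0 \<and> 0 \<le> Re (fourier f \<xi>))"

definition supported_in :: "(real ^ 'd \<Rightarrow> complex) \<Rightarrow> (real ^ 'd) set \<Rightarrow> bool" where
  "supported_in f S \<longleftrightarrow> (\<forall>x. x \<notin> S \<longrightarrow> f x = 0)"

definition turan_admissible :: "(real ^ 'd) set \<Rightarrow> (real ^ 'd \<Rightarrow> complex) \<Rightarrow> bool" where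
  "turan_admissible S f \<longleftrightarrow> positive_definite f \<and> supported_in f S \<and> f 0 = 1"

definition turan_extremal :: "(real ^ 'd) set \<Rightarrow> real ^ 'd \<Rightarrow> complex" where
  "turan_extremal S x =
     of_real (2 ^ CARD('d) / measure lebesgue S) *
     convolution (indicator ((*\<^sub>R) (1/2) ` S)) (indicator ((*\<^sub>R) (1/2) ` S)) x"

text \<open>
  The integral of an admissible function is the value of its Fourier transform at \<open>0\<close>,
  hence a nonnegative real number, so comparing real parts loses nothing.
\<close>

definition turan_domain :: "(real ^ 'd) set \<Rightarrow> bool" where
  "turan_domain S \<longleftrightarrow>
     is_domain S \<and> convex S \<and> symmetric_set S \<and>
     turan_admissible S (turan_extremal S) \<and>
     (\<forall>f. turan_admissible S f \<longrightarrow>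
        Re (LINT x|lebesgue. f x) \<le> Re (LINT x|lebesgue. turan_extremal S x))"

end

theory Submission
  imports Defs "HOL-Probability.Characteristic_Functions"
begin

text \<open>
  An admissible \<open>f\<close> is a superposition \<open>f u = \<integral> w \<xi> * cis (2 * pi * (\<xi> \<bullet> u)) \<partial>\<xi>\<close> with
  \<open>w \<ge> 0\<close> integrable: regularise its transform by Gaussians and let their width grow.
  If \<open>\<Omega> = - \<Omega>\<close> tiles with \<open>L\<close>, disjointness of the tiles forces \<open>(l - l') / 2 \<notin> \<Omega>\<close>, so
  \<open>f\<close> vanishes at all nonzero differences of \<open>L / 2\<close>, a set of density \<open>c = 2\<^sup>d / \<bar>\<Omega>\<bar>\<close>.
  Test positive definiteness of \<open>f\<close> on the signed measure given by the unit masses at the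
  points of \<open>L / 2\<close> in a ball of radius \<open>r\<close>, minus \<open>c\<close> times Lebesgue measure on a slightly
  larger ball. Dividing by the volume of the ball and letting \<open>r\<close> tend to infinity leaves
  \<open>0 \<le> c - 2 c\<^sup>2 I + c\<^sup>2 I\<close> for \<open>I = \<integral> f\<close>, i.e. \<open>I \<le> \<bar>\<Omega>\<bar> / 2\<^sup>d\<close>.
\<close>

subsection \<open>Fourier inversion for nonnegative transforms\<close>

text \<open>\<open>lborel\<close> is the image of the product of one-dimensional Lebesgue measures
  under the map that assembles a vector from its coordinates. Pulled back along it, the integrand
  separates into factors of one variable each.\<close>

lemma lborel_prod_Basis:
  fixes f :: "'a::euclidean_space \<Rightarrow> real \<Rightarrow> complex"
  assumes f: "\<And>b. b \<in> Basis \<Longrightarrow> integrable lborel (f b)"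
  shows integrable_lborel_prod_Basis: "integrable lborel (\<lambda>x::'a. \<Prod>b\<in>Basis. f b (x \<bullet> b))"
    and integral_lborel_prod_Basis:
      "(LINT x|(lborel :: 'a measure). (\<Prod>b\<in>Basis. f b (x \<bullet> b))) = (\<Prod>b\<in>Basis. LINT x|lborel. f b x)"
proof -
  interpret product_sigma_finite "\<lambda>_::'a. lborel :: real measure" ..
  have [measurable]: "f b \<in> borel_measurable borel" if "b \<in> Basis" for b
    using f[OF that] by (auto dest: borel_measurable_integrable)
  have eq: "(\<Prod>b\<in>Basis. f b ((\<Sum>c\<in>Basis. x c *\<^sub>R c) \<bullet> b)) = (\<Prod>b\<in>Basis. f b (x b))" for x
    by (intro prod.cong) (auto simp: inner_sum_left inner_Basis if_distrib cong: if_cong)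
  show "integrable lborel (\<lambda>x::'a. \<Prod>b\<in>Basis. f b (x \<bullet> b))"
    by (subst lborel_eq, subst integrable_distr_eq)
       (auto simp: eq intro!: product_integrable_prod f)
  show "(LINT x|(lborel :: 'a measure). (\<Prod>b\<in>Basis. f b (x \<bullet> b))) = (\<Prod>b\<in>Basis. LINT x|lborel. f b x)"
    by (subst lborel_eq, subst integral_distr)
       (auto simp: eq intro!: product_integral_prod f)
qed

section \<open>Affine substitution, and Fubini with a bounded kernel\<close>

lemma lborel_integral_scaleR:
  fixes f :: "'a::euclidean_space \<Rightarrow> complex"
  assumes c: "c \<noteq> 0" and [measurable]: "f \<in> borel_measurable borel"
  shows "(LINT x|lborel. f x) = \<bar>c\<bar> ^ DIM('a) *\<^sub>R (LINT x|lborel. f (t + c *\<^sub>R x))"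
  by (subst lborel_affine[OF c, of t]) (simp add: integral_density integral_distr)

lemma lborel_integrable_scaleR:
  fixes f :: "'a::euclidean_space \<Rightarrow> complex"
  assumes c: "c \<noteq> 0" and f: "integrable lborel f"
  shows "integrable lborel (\<lambda>x. f (t + c *\<^sub>R x))"
proof -
  have [measurable]: "f \<in> borel_measurable borel" using f by auto
  have "integrable (density (distr lborel borel (\<lambda>x. t + c *\<^sub>R x)) (\<lambda>_. ennreal (\<bar>c\<bar>^DIM('a)))) f"
    using f lborel_affine[OF c, of t] by simp
  then have "integrable lborel (\<lambda>x. \<bar>c\<bar>^DIM('a) *\<^sub>R f (t + c *\<^sub>R x))"
    by (simp add: integrable_density integrable_distr_eq del: integrable_scaleR_right scaleR_power)
  from integrable_scaleR_right[OF this, of "inverse (\<bar>c\<bar>^DIM('a))"] show ?thesis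
    using c by simp
qed

lemma integrable_pair_kernel:
  fixes g :: "'a::euclidean_space \<Rightarrow> complex" and h :: "'b::euclidean_space \<Rightarrow> complex"
  assumes g: "integrable lborel g" and h: "integrable lborel h"
    and [measurable]: "case_prod k \<in> borel_measurable (borel \<Otimes>\<^sub>M borel)"
    and k: "\<And>x y. norm (k x y) \<le> (1::real)"
  shows "integrable (lborel \<Otimes>\<^sub>M lborel) (\<lambda>(x, y). g x * h y * k x y)"
proof -
  have [measurable]: "g \<in> borel_measurable borel" "h \<in> borel_measurable borel" using g h by auto
  have "integrable (lborel \<Otimes>\<^sub>M lborel) (\<lambda>p. g (fst p) * h (snd p))"
    by (rule lborel_pair.Fubini_integrable) (auto simp: norm_mult intro!: g h integrable_norm)
  then show ?thesis
    by (rule Bochner_Integration.integrable_bound)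
       (auto simp: norm_mult split_beta intro!: mult_left_le k)
qed

text \<open>The common form of the interchanges of integrals below: \<open>g\<close> and
  \<open>h\<close> carry the integrability, and \<open>k\<close> is a character, possibly times a
  translated indicator, hence bounded by 1.\<close>

lemma Fubini_kernel:
  fixes g :: "'a::euclidean_space \<Rightarrow> complex" and h :: "'b::euclidean_space \<Rightarrow> complex"
  assumes "integrable lborel g" "integrable lborel h"
    and "case_prod k \<in> borel_measurable (borel \<Otimes>\<^sub>M borel)"
    and "\<And>x y. norm (k x y) \<le> (1::real)"
  shows "(LINT x|lborel. g x * (LINT y|lborel. h y * k x y)) =
         (LINT y|lborel. h y * (LINT x|lborel. g x * k x y))"
proof -
  have "(LINT x|lborel. LINT y|lborel. g x * h y * k x y) = (LINT y|lborel. LINT x|lborel. g x * h y * k x y)"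
    using lborel_pair.Fubini_integral[OF integrable_pair_kernel[OF assms]] by simp
  moreover have "g x * h y * k x y = h y * (g x * k x y)" for x y by simp
  ultimately show ?thesis by (simp only: integral_mult_right_zero mult.assoc)
qed

section \<open>Gaussians and their Fourier integrals\<close>

definition gauss :: "'a::euclidean_space \<Rightarrow> real" where
  "gauss x = exp (- (norm x)\<^sup>2 / 2)"

lemma gauss_pos: "0 < gauss x" and gauss_le_1: "gauss x \<le> 1" and gauss_minus [simp]: "gauss (- x) = gauss x"
  by (auto simp: gauss_def)

lemma borel_measurable_gauss [measurable]: "gauss \<in> borel_measurable borel"
  unfolding gauss_def[abs_def] by measurable

text \<open>Up to the factor \<open>sqrt (2 * pi)\<close> the integrand is the standard normal
  density times a character, so the value comes from the characteristic function of the standard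
  normal distribution.\<close>

lemma gauss_real_char:
  fixes t :: real
  shows "integrable lborel (\<lambda>x::real. of_real (exp (- x\<^sup>2 / 2)) * cis (t * x))"
    and "(LINT x|lborel. of_real (exp (- x\<^sup>2 / 2)) * cis (t * x)) = of_real (sqrt (2 * pi) * exp (- t\<^sup>2 / 2))"
proof -
  have eq: "of_real (exp (- x\<^sup>2 / 2)) * cis (t * x) = of_real (sqrt (2 * pi)) * (std_normal_density x *\<^sub>R cis (t * x))" for x
    by (simp add: std_normal_density_def scaleR_conv_of_real)
  have "integrable lborel (\<lambda>x. std_normal_density x *\<^sub>R cis (t * x))"
    by (rule Bochner_Integration.integrable_bound[OF integrable_std_normal_moment[of 0]])
      (auto simp: cis_conv_exp)
  then show "integrable lborel (\<lambda>x::real. of_real (exp (- x\<^sup>2 / 2)) * cis (t * x))"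
    unfolding eq by (rule integrable_mult_right)
  have "(LINT x|lborel. std_normal_density x *\<^sub>R cis (t * x)) = char std_normal_distribution t"
    unfolding char_def by (subst integral_density) (auto simp: cis_conv_exp)
  then show "(LINT x|lborel. of_real (exp (- x\<^sup>2 / 2)) * cis (t * x)) = of_real (sqrt (2 * pi) * exp (- t\<^sup>2 / 2))"
    unfolding eq integral_mult_right_zero by (simp add: char_std_normal_distribution)
qed

text \<open>Both the Gaussian and the character factor over the coordinates, which reduces the claim
  to dimension one.\<close>

lemma gauss_char:
  fixes t :: "'a::euclidean_space"
  shows "integrable lborel (\<lambda>x::'a. of_real (gauss x) * cis (t \<bullet> x))"
    and "(LINT x|lborel. of_real (gauss x) * cis (t \<bullet> x)) = of_real (sqrt (2 * pi) ^ DIM('a) * gauss t)"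
proof -
  have g: "gauss x = (\<Prod>b\<in>Basis. exp (- (x \<bullet> b)\<^sup>2 / 2))" for x :: 'a
    unfolding gauss_def exp_sum[OF finite_Basis, symmetric] power2_norm_eq_inner
    by (subst euclidean_inner) (simp add: sum_negf sum_divide_distrib power2_eq_square)
  have c: "cis (t \<bullet> x) = (\<Prod>b\<in>Basis. cis ((t \<bullet> b) * (x \<bullet> b)))" for x
    unfolding cis_conv_exp exp_sum[OF finite_Basis, symmetric]
    by (subst euclidean_inner) (simp add: sum_distrib_left)
  have eq: "of_real (gauss x) * cis (t \<bullet> x) =
      (\<Prod>b\<in>Basis. of_real (exp (- (x \<bullet> b)\<^sup>2 / 2)) * cis ((t \<bullet> b) * (x \<bullet> b)))" for x
    unfolding g c of_real_prod prod.distrib ..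
  show "integrable lborel (\<lambda>x::'a. of_real (gauss x) * cis (t \<bullet> x))"
    unfolding eq by (rule integrable_lborel_prod_Basis gauss_real_char)+
  show "(LINT x|lborel. of_real (gauss x) * cis (t \<bullet> x)) = of_real (sqrt (2 * pi) ^ DIM('a) * gauss t)"
    unfolding eq integral_lborel_prod_Basis[OF gauss_real_char(1)] gauss_real_char(2)
    by (simp add: g prod.distrib)
qed

lemma integrable_gauss_scaleR:
  assumes "c \<noteq> 0"
  shows "integrable lborel (\<lambda>x::'a::euclidean_space. gauss (c *\<^sub>R x))"
  using integrable_Re[OF lborel_integrable_scaleR[OF assms gauss_char(1)[of 0], of 0]] by simp

text \<open>The Fourier transform written with \<open>lborel\<close> and \<open>cis\<close> on any
  Euclidean space, where Borel measurability and Fubini are directly at hand.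
  \<open>fourier_eq_char_transform\<close> connects it with \<open>fourier\<close>.\<close>

definition char_transform :: "('a::euclidean_space \<Rightarrow> complex) \<Rightarrow> 'a \<Rightarrow> complex" where
  "char_transform f \<xi> = (LINT x|lborel. f x * cis (- (2 * pi * (\<xi> \<bullet> x))))"

lemma borel_measurable_char_transform:
  assumes [measurable]: "f \<in> borel_measurable borel"
  shows "char_transform f \<in> borel_measurable borel"
  unfolding char_transform_def[abs_def] cis_conv_exp by measurable

lemma cis_measurable [measurable]:
  "g \<in> borel_measurable M \<Longrightarrow> (\<lambda>x. cis (g x)) \<in> borel_measurable M"
  unfolding cis_conv_exp by measurable

text \<open>Inverting the transform with a Gaussian damping factor yields an average of
  \<open>f\<close> around \<open>u\<close> at scale \<open>e\<close>: after Fubini, the integral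
  over the frequencies is again a Gaussian, centred at \<open>u\<close> and concentrated at scale
  \<open>e\<close>.\<close>

lemma char_transform_gauss_regularised:
  fixes f :: "'a::euclidean_space \<Rightarrow> complex"
  assumes f: "integrable lborel f" and e: "0 < e"
  shows "(LINT \<xi>|lborel. char_transform f \<xi> * of_real (gauss (e *\<^sub>R \<xi>)) * cis (2 * pi * (\<xi> \<bullet> u)))
    = of_real (sqrt (2 * pi) ^ DIM('a)) * (LINT s|lborel. f (u + e *\<^sub>R s) * of_real (gauss ((2 * pi) *\<^sub>R s)))"
proof -
  have [measurable]: "f \<in> borel_measurable borel" using f by auto
  have inner: "(LINT \<xi>|lborel. of_real (gauss (e *\<^sub>R \<xi>)) * cis (2 * pi * (\<xi> \<bullet> (u - x))))
      = of_real ((1 / e) ^ DIM('a) * sqrt (2 * pi) ^ DIM('a) * gauss ((2 * pi / e) *\<^sub>R (x - u)))" for x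
  proof -
    have "(LINT \<xi>|lborel. of_real (gauss (e *\<^sub>R \<xi>)) * cis (2 * pi * (\<xi> \<bullet> (u - x))))
      = \<bar>1 / e\<bar> ^ DIM('a) *\<^sub>R (LINT \<xi>|lborel. of_real (gauss \<xi>) * cis (((2 * pi / e) *\<^sub>R (u - x)) \<bullet> \<xi>))"
      using e by (subst lborel_integral_scaleR[where c = "1 / e" and t = 0]) (auto simp: inner_commute)
    moreover have "gauss ((2 * pi / e) *\<^sub>R (u - x)) = gauss ((2 * pi / e) *\<^sub>R (x - u))"
      by (subst gauss_minus[symmetric]) (simp del: gauss_minus flip: scaleR_minus_right)
    ultimately show ?thesis using e
      unfolding gauss_char by (simp add: scaleR_conv_of_real)
  qed
  have "(LINT \<xi>|lborel. char_transform f \<xi> * of_real (gauss (e *\<^sub>R \<xi>)) * cis (2 * pi * (\<xi> \<bullet> u)))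
    = (LINT \<xi>|lborel. of_real (gauss (e *\<^sub>R \<xi>)) * (LINT x|lborel. f x * cis (2 * pi * (\<xi> \<bullet> (u - x)))))"
  proof (intro Bochner_Integration.integral_cong refl)
    fix \<xi>
    have "(LINT x|lborel. f x * cis (2 * pi * (\<xi> \<bullet> (u - x)))) = (LINT x|lborel. f x * cis (- (2 * pi * (\<xi> \<bullet> x))) * cis (2 * pi * (\<xi> \<bullet> u)))"
      by (intro Bochner_Integration.integral_cong refl) (simp add: inner_diff_right cis_mult algebra_simps)
    then show "char_transform f \<xi> * of_real (gauss (e *\<^sub>R \<xi>)) * cis (2 * pi * (\<xi> \<bullet> u))
      = of_real (gauss (e *\<^sub>R \<xi>)) * (LINT x|lborel. f x * cis (2 * pi * (\<xi> \<bullet> (u - x))))"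
      by (simp add: char_transform_def)
  qed
  also have "\<dots> = (LINT x|lborel. f x * (LINT \<xi>|lborel. of_real (gauss (e *\<^sub>R \<xi>)) * cis (2 * pi * (\<xi> \<bullet> (u - x)))))"
    using e by (intro Fubini_kernel integrable_of_real integrable_gauss_scaleR f) (auto simp: split_beta)
  \<comment> \<open>Substitute \<open>x = u + e *\<^sub>R s\<close>; the Jacobian cancels the factor
    \<open>(1 / e) ^ DIM('a)\<close> left by \<open>inner\<close>.\<close>
  also have "\<dots> = \<bar>e\<bar> ^ DIM('a) *\<^sub>R (LINT s|lborel. f (u + e *\<^sub>R s) *
       of_real ((1 / e) ^ DIM('a) * sqrt (2 * pi) ^ DIM('a) * gauss ((2 * pi) *\<^sub>R s)))"
    unfolding inner using e by (subst lborel_integral_scaleR[where c = e and t = u]) auto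
  also have "\<dots> = of_real (sqrt (2 * pi) ^ DIM('a)) * (LINT s|lborel. f (u + e *\<^sub>R s) * of_real (gauss ((2 * pi) *\<^sub>R s)))"
    using e unfolding integral_mult_right_zero[symmetric] integral_scaleR_right[symmetric]
    by (intro Bochner_Integration.integral_cong) (auto simp: scaleR_conv_of_real power_divide)
  finally show ?thesis .
qed

text \<open>The damped inversion integrals at \<open>u = 0\<close> converge to a multiple of
  \<open>f 0\<close>. Since the transform is nonnegative, monotone convergence turns this into its
  integrability, and then dominated convergence gives inversion at every \<open>u\<close>. The
  normalising constant \<open>D * K\<close> is left unevaluated and divided out at the end.\<close>

lemma continuous_char_inversion:
  fixes f :: "'a::euclidean_space \<Rightarrow> complex"
  assumes cont: "continuous_on UNIV f" and int: "integrable lborel f" and B: "\<And>x. norm (f x) \<le> B"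
    and nonneg: "\<And>\<xi>. Im (char_transform f \<xi>) = 0" "\<And>\<xi>. 0 \<le> Re (char_transform f \<xi>)"
  obtains w where "\<And>\<xi>. 0 \<le> w \<xi>" "integrable lborel w"
    "\<And>u. f u = (LINT \<xi>|lborel. of_real (w \<xi>) * cis (2 * pi * (\<xi> \<bullet> u)))"
proof -
  define F where "F \<xi> = Re (char_transform f \<xi>)" for \<xi>
  have F: "char_transform f \<xi> = of_real (F \<xi>)" and F_ge: "0 \<le> F \<xi>" for \<xi>
    using nonneg by (auto simp: F_def complex_eq_iff)
  have [measurable]: "f \<in> borel_measurable borel" using int by auto
  have [measurable]: "F \<in> borel_measurable borel"
    using borel_measurable_char_transform[of f] unfolding F_def[abs_def] by measurable
  define e where "e n = inverse (real (Suc n))" for n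
  have e: "0 < e n" "e n \<le> 1" for n by (auto simp: e_def divide_simps)
  have e_lim: "e \<longlonglongrightarrow> 0" unfolding e_def[abs_def] by (rule LIMSEQ_inverse_real_of_nat)
  have e_mono: "e n \<le> e m" if "m \<le> n" for m n using that by (auto simp: e_def divide_simps)
  define K where "K = (LINT s|lborel. gauss ((2 * pi) *\<^sub>R s :: 'a))"
  define D where "D = sqrt (2 * pi) ^ DIM('a)"
  have D: "D > 0" by (simp add: D_def)
  have gi: "integrable lborel (\<lambda>s::'a. gauss ((2 * pi) *\<^sub>R s))"
    using integrable_gauss_scaleR[of "2 * pi", where 'a = 'a] by simp
  have K: "K > 0" 
  proof -
    have "K \<ge> 0" unfolding K_def by (simp add: gauss_pos less_imp_le)
    \<comment> \<open>The integrand is positive everywhere, so a vanishing integral would make the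
      whole space a null set.\<close>
    moreover have "K \<noteq> 0"
      unfolding K_def using gi
      using AE_iff_null_sets[of "UNIV :: 'a set" lborel]
      by (subst integral_nonneg_eq_0_iff_AE)
        (auto simp: gauss_pos less_imp_le gauss_pos[THEN less_imp_neq, symmetric] null_sets_def)
    ultimately show ?thesis by simp
  qed
  have lim_e: "(\<lambda>n. x + e n *\<^sub>R s) \<longlonglongrightarrow> x" for x s :: 'a
    using tendsto_add[OF tendsto_const[of x] tendsto_scaleR[OF e_lim tendsto_const[of s]]] by simp
  have rhs_lim: "(\<lambda>n. LINT s|lborel. f (u + e n *\<^sub>R s) * of_real (gauss ((2 * pi) *\<^sub>R s))) \<longlonglongrightarrow> f u * of_real K" for u
  proof -
    have "(\<lambda>n. LINT s|lborel. f (u + e n *\<^sub>R s) * of_real (gauss ((2 * pi) *\<^sub>R s)))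
        \<longlonglongrightarrow> (LINT s|lborel. f u * of_real (gauss ((2 * pi) *\<^sub>R s :: 'a)))"
    proof (rule integral_dominated_convergence[where w = "\<lambda>s :: 'a. B * gauss ((2 * pi) *\<^sub>R s)"])
      show "integrable lborel (\<lambda>s. B * gauss ((2 * pi) *\<^sub>R s :: 'a))"
        using gi by simp
      show "AE s in lborel. (\<lambda>n. f (u + e n *\<^sub>R s) * of_real (gauss ((2 * pi) *\<^sub>R s))) \<longlonglongrightarrow>
          f u * complex_of_real (gauss ((2 * pi) *\<^sub>R s :: 'a))"
      proof (intro AE_I2 tendsto_mult tendsto_const)
        fix s
        show "(\<lambda>n. f (u + e n *\<^sub>R s)) \<longlonglongrightarrow> f u"
          using cont lim_e[of u s] by (intro continuous_on_tendsto_compose[OF cont]) auto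
      qed
    qed (auto simp: norm_mult gauss_pos less_imp_le intro!: mult_right_mono B)
    then show ?thesis by (simp add: K_def)
  qed
  define I where "I u n = (LINT \<xi>|lborel. of_real (F \<xi> * gauss (e n *\<^sub>R \<xi>)) * cis (2 * pi * (\<xi> \<bullet> u)))" for u n
  have I_lim: "I u \<longlonglongrightarrow> of_real (D * K) * f u" for u
    using tendsto_mult[OF tendsto_const[of "of_real D"] rhs_lim[of u]] char_transform_gauss_regularised[OF int e(1), of _ u]
    unfolding I_def[abs_def] F D_def by (simp add: mult_ac)
  have gauss_lim: "(\<lambda>n. gauss (e n *\<^sub>R x)) \<longlonglongrightarrow> 1" for x :: 'a
  proof -
    have "(\<lambda>n. exp (- (norm (e n *\<^sub>R x))\<^sup>2 / 2)) \<longlonglongrightarrow> exp (- (norm (0 *\<^sub>R x))\<^sup>2 / 2)"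
      by (intro tendsto_intros e_lim) auto
    then show ?thesis by (simp add: gauss_def)
  qed
  have F_bound: "norm (char_transform f \<xi>) \<le> (LINT x|lborel. norm (f x))" for \<xi>
    unfolding char_transform_def by (rule order.trans[OF integral_norm_bound]) (simp add: norm_mult)
  \<comment> \<open>The transform is bounded by the integral of \<open>norm (f x)\<close>, so the
    Gaussian alone ensures integrability.\<close>
  have int_n: "integrable lborel (\<lambda>\<xi>. F \<xi> * gauss (e n *\<^sub>R \<xi>))" for n
  proof (rule Bochner_Integration.integrable_bound)
    show "integrable lborel (\<lambda>\<xi>::'a. (LINT x|lborel. norm (f x)) * gauss (e n *\<^sub>R \<xi>))"
      using integrable_gauss_scaleR[of "e n", where 'a = 'a] e(1)[of n] by simp
    show "AE x in lborel. norm (F x * gauss (e n *\<^sub>R x)) \<le> norm ((LINT x|lborel. norm (f x)) * gauss (e n *\<^sub>R x))"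
      using F_bound F_ge by (auto simp: F abs_mult gauss_pos less_imp_le intro!: mult_right_mono)
  qed measurable
  have I0: "LINT \<xi>|lborel. F \<xi> * gauss (e n *\<^sub>R \<xi>) = Re (I 0 n)" for n
    unfolding I_def by (simp flip: of_real_mult)
  \<comment> \<open>As \<open>e n\<close> decreases, the damped transforms increase to
    \<open>F\<close>, and by \<open>I_lim\<close> at \<open>0\<close> their integrals have a finite
    limit.\<close>
  have F_int: "integrable lborel F"
  proof (rule integral_monotone_convergence_nonneg(1)[OF int_n])
    show "AE x in lborel. mono (\<lambda>n. F x * gauss (e n *\<^sub>R x))"
    proof (intro AE_I2 monoI mult_left_mono F_ge)
      fix x :: 'a and m n :: nat assume "m \<le> n"
      then have "(e n * norm x)\<^sup>2 \<le> (e m * norm x)\<^sup>2"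
        using e(1)[of n] by (intro power_mono mult_right_mono e_mono) auto
      then show "gauss (e m *\<^sub>R x) \<le> gauss (e n *\<^sub>R x)"
        using e(1)[of n] e(1)[of m] by (simp add: gauss_def)
    qed
    show "AE x in lborel. 0 \<le> F x * gauss (e n *\<^sub>R x)" for n
      by (auto simp: F_ge gauss_pos less_imp_le)
    show "AE x in lborel. (\<lambda>n. F x * gauss (e n *\<^sub>R x)) \<longlonglongrightarrow> F x"
      using tendsto_mult[OF tendsto_const gauss_lim] by auto
    show "(\<lambda>n. LINT \<xi>|lborel. F \<xi> * gauss (e n *\<^sub>R \<xi>)) \<longlonglongrightarrow> Re (of_real (D * K) * f 0)"
      unfolding I0 by (intro tendsto_Re I_lim)
  qed simp
  have "I u \<longlonglongrightarrow> (LINT \<xi>|lborel. of_real (F \<xi>) * cis (2 * pi * (\<xi> \<bullet> u)))" for u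
    unfolding I_def
  proof (rule integral_dominated_convergence[where w = F])
    show "AE x in lborel. (\<lambda>n. complex_of_real (F x * gauss (e n *\<^sub>R x)) * cis (2 * pi * (x \<bullet> u)))
        \<longlonglongrightarrow> of_real (F x) * cis (2 * pi * (x \<bullet> u))"
      using tendsto_mult[OF tendsto_const gauss_lim]
      by (intro AE_I2 tendsto_mult tendsto_of_real tendsto_const) auto
    show "AE x in lborel. norm (complex_of_real (F x * gauss (e n *\<^sub>R x)) * cis (2 * pi * (x \<bullet> u))) \<le> F x" for n
      by (auto simp: norm_mult gauss_pos less_imp_le F_ge intro!: mult_left_le gauss_le_1)
  qed (auto intro: F_int)
  with I_lim have *: "of_real (D * K) * f u = (LINT \<xi>|lborel. of_real (F \<xi>) * cis (2 * pi * (\<xi> \<bullet> u)))" for u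
    by (blast intro: LIMSEQ_unique)
  show thesis
  proof
    show "0 \<le> F \<xi> / (D * K)" for \<xi> using F_ge D K by simp
    show "integrable lborel (\<lambda>\<xi>. F \<xi> / (D * K))" using F_int by simp
    have "(LINT \<xi>|lborel. of_real (F \<xi> / (D * K)) * cis (2 * pi * (\<xi> \<bullet> u)))
       = inverse (of_real (D * K)) * (LINT \<xi>|lborel. of_real (F \<xi>) * cis (2 * pi * (\<xi> \<bullet> u)))" for u
      unfolding integral_mult_right_zero[symmetric]
      by (intro Bochner_Integration.integral_cong) (simp_all add: divide_inverse)
    then show "f u = (LINT \<xi>|lborel. of_real (F \<xi> / (D * K)) * cis (2 * pi * (\<xi> \<bullet> u)))" for u
      using D K by (simp flip: *)
  qed
qed

subsection \<open>The quadratic form of a packing\<close>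

lemma lborel_integral_reflect:
  fixes f :: "'a::euclidean_space \<Rightarrow> complex"
  assumes [measurable]: "f \<in> borel_measurable borel"
  shows "(LINT y|lborel. f (x - y)) = (LINT y|lborel. f y)"
  using lborel_integral_scaleR[of "-1" f x] by simp

lemma lborel_integral_shift:
  fixes f :: "'a::euclidean_space \<Rightarrow> complex"
  assumes [measurable]: "f \<in> borel_measurable borel"
  shows "(LINT y|lborel. f (y - x)) = (LINT y|lborel. f y)"
  using lborel_integral_scaleR[of 1 f "- x"] by simp

lemma lborel_integrable_shift:
  fixes f :: "'a::euclidean_space \<Rightarrow> complex"
  assumes "integrable lborel f"
  shows "integrable lborel (\<lambda>y. f (y - x))"
  using lborel_integrable_scaleR[of 1 f "- x"] assms by simp

lemma integrable_indicator_complex: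
  assumes "A \<in> sets lborel" "emeasure lborel A < \<infinity>"
  shows "integrable lborel (indicator A :: 'a::euclidean_space \<Rightarrow> complex)"
proof -
  have "integrable lborel (\<lambda>x. complex_of_real (indicator A x))"
    using assms by (intro integrable_of_real integrable_real_indicator)
  then show ?thesis by (simp add: of_real_indicator)
qed

text \<open>With \<open>P\<close> and \<open>D\<close> the Fourier integrals of the unit masses on
  \<open>L\<close> and of Lebesgue measure on the ball of radius \<open>r + a\<close>, the integral
  of \<open>w \<xi> * (norm (P \<xi> - c * D \<xi>))\<^sup>2\<close> is nonnegative. Expanding the
  square gives three terms: the first two are computed exactly, the last is bounded from
  above.\<close>

lemma packing_quadratic_form:
  fixes f :: "'a::euclidean_space \<Rightarrow> complex" and a c r :: real
  assumes w: "\<And>\<xi>. 0 \<le> w \<xi>" "integrable lborel w"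
    and fw: "\<And>u. f u = (LINT \<xi>|lborel. of_real (w \<xi>) * cis (2 * pi * (\<xi> \<bullet> u)))"
    and int: "integrable lborel f" and supp: "\<And>x. f x \<noteq> 0 \<Longrightarrow> norm x < a"
    and L: "finite L" "L \<subseteq> ball 0 r"
    and pack: "\<And>l l'. l \<in> L \<Longrightarrow> l' \<in> L \<Longrightarrow> l \<noteq> l' \<Longrightarrow> f (l - l') = 0"
    and a: "a \<ge> 0"
  defines "I \<equiv> Re (LINT x|lborel. f x)" and "K \<equiv> LINT x|lborel. norm (f x)"
  shows "0 \<le> card L * Re (f 0) - 2 * c * card L * I
    + c\<^sup>2 * (K * measure lborel (ball (0::'a) (r + a)) - (K - I) * measure lborel (ball (0::'a) r))"
proof -
  define Q where "Q = (indicator (ball 0 (r + a)) :: 'a \<Rightarrow> complex)"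
  define P where "P \<xi> = (\<Sum>l\<in>L. cis (2 * pi * (\<xi> \<bullet> l)))" for \<xi>
  define D where "D \<xi> = (LINT y|lborel. Q y * cis (2 * pi * (\<xi> \<bullet> y)))" for \<xi>
  define W where "W \<xi> = complex_of_real (w \<xi>)" for \<xi>
  define J where "J y = (LINT x|lborel. Q x * f (x - y))" for y
  have [measurable]: "f \<in> borel_measurable borel" "w \<in> borel_measurable borel" using int w by auto
  have [measurable]: "Q \<in> borel_measurable borel"
    unfolding Q_def by (intro borel_measurable_indicator) simp
  have [measurable]: "P \<in> borel_measurable borel" "D \<in> borel_measurable borel" "W \<in> borel_measurable borel"
     "J \<in> borel_measurable borel"
    unfolding P_def[abs_def] D_def[abs_def] W_def[abs_def] J_def[abs_def] by measurable
  have Qi: "integrable lborel Q"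
    unfolding Q_def by (intro integrable_indicator_complex emeasure_bounded_finite) auto
  have Wi: "integrable lborel W" using w unfolding W_def[abs_def] by simp
  have Pb: "norm (P \<xi>) \<le> card L" for \<xi>
    unfolding P_def by (rule order.trans[OF norm_sum]) simp
  have Db: "norm (D \<xi>) \<le> (LINT y|lborel. norm (Q y))" for \<xi>
    unfolding D_def by (rule order.trans[OF integral_norm_bound]) (simp add: norm_mult)
  \<comment> \<open>The weight is integrable, so any bounded measurable factor is allowed; all
    integrands in \<xi> below are of this kind.\<close>
  have Wg: "integrable lborel (\<lambda>\<xi>. W \<xi> * g \<xi>)"
    if [measurable]: "g \<in> borel_measurable borel" and "\<And>\<xi>. norm (g \<xi>) \<le> B" for g B
  proof (rule Bochner_Integration.integrable_bound)
    show "integrable lborel (\<lambda>\<xi>. of_real B * W \<xi>)" using Wi by simp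
    show "AE x in lborel. norm (W x * g x) \<le> norm (of_real B * W x)"
    proof (rule AE_I2)
      fix x
      have "norm (g x) \<le> \<bar>B\<bar>" using that(2)[of x] by simp
      then show "norm (W x * g x) \<le> norm (of_real B * W x)"
        by (simp add: norm_mult mult.commute[of "norm (W x)"] mult_right_mono)
    qed
  qed measurable
  have cnjD: "cnj (D \<xi>) = (LINT y|lborel. Q y * cis (- (2 * pi * (\<xi> \<bullet> y))))" for \<xi>
    unfolding D_def Bochner_Integration.integral_cnj[symmetric]
    by (intro Bochner_Integration.integral_cong) (auto simp: Q_def indicator_def cis_cnj)
  \<comment> \<open>Writing \<open>cnj (D \<xi>)\<close> as an integral over \<open>y\<close> and
    exchanging the order brings the representation of \<open>f\<close> by \<open>w\<close> into the
    inner integral.\<close>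
  have WD: "(LINT \<xi>|lborel. W \<xi> * (g \<xi> * cnj (D \<xi>)))
      = (LINT y|lborel. Q y * (LINT \<xi>|lborel. W \<xi> * (g \<xi> * cis (- (2 * pi * (\<xi> \<bullet> y))))))"
    if "g \<in> borel_measurable borel" "\<And>\<xi>. norm (g \<xi>) \<le> B" for g B
    using Fubini_kernel[OF Wg[OF that] Qi, of "\<lambda>\<xi> y. cis (- (2 * pi * (\<xi> \<bullet> y)))"]
    by (simp add: cnjD split_beta mult.assoc)
  \<comment> \<open>This is the reason for enlarging the ball by \<open>a\<close>: seen from a point
    of norm below \<open>r\<close>, the whole support of \<open>f\<close> lies inside it, so the
    cutoff \<open>Q\<close> has no effect. The same holds for \<open>Jf\<close>.\<close>
  have Qf: "(LINT y|lborel. Q y * f (l - y)) = (LINT x|lborel. f x)" if "norm l < r" for l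
  proof -
    have "f (l - y) = 0" if "y \<notin> ball 0 (r + a)" for y
      using supp[of "l - y"] that \<open>norm l < r\<close> norm_triangle_ineq4[of l "l - y"] by force
    then have "(LINT y|lborel. Q y * f (l - y)) = (LINT y|lborel. f (l - y))"
      by (intro Bochner_Integration.integral_cong) (auto simp: Q_def indicator_def)
    then show ?thesis by (simp add: lborel_integral_reflect)
  qed
  have Jf: "J y = (LINT x|lborel. f x)" if "norm y < r" for y
  proof -
    have "f (x - y) = 0" if "x \<notin> ball 0 (r + a)" for x
      using supp[of "x - y"] that \<open>norm y < r\<close> norm_triangle_ineq[of y "x - y"] by force
    then have "J y = (LINT x|lborel. f (x - y))"
      unfolding J_def by (intro Bochner_Integration.integral_cong) (auto simp: Q_def indicator_def)
    then show ?thesis by (simp add: lborel_integral_shift)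
  qed
  have JK: "norm (J y) \<le> K" for y
  proof -
    have "norm (J y) \<le> (LINT x|lborel. norm (f (x - y)))"
      unfolding J_def
      by (rule order.trans[OF integral_norm_bound], rule integral_mono')
        (auto intro!: integrable_norm lborel_integrable_shift int simp: Q_def norm_mult indicator_def)
    also have "\<dots> = Re (LINT x|lborel. of_real (norm (f (x - y))))" by simp
    also have "\<dots> = K" unfolding K_def
      by (subst lborel_integral_shift[of "\<lambda>x. of_real (norm (f x))"]) auto
    finally show ?thesis .
  qed
  \<comment> \<open>The double sum of \<open>f (l - l')\<close> reduces to its diagonal by
    \<open>pack\<close>.\<close>
  have PP: "(LINT \<xi>|lborel. W \<xi> * (P \<xi> * cnj (P \<xi>))) = of_nat (card L) * f 0"
  proof -
    have "W \<xi> * (P \<xi> * cnj (P \<xi>)) = (\<Sum>l\<in>L. \<Sum>l'\<in>L. W \<xi> * cis (2 * pi * (\<xi> \<bullet> (l - l'))))" for \<xi>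
      unfolding P_def cnj_sum sum_product
      by (simp add: cis_cnj cis_mult sum_distrib_left inner_diff_right algebra_simps)
    then have "(LINT \<xi>|lborel. W \<xi> * (P \<xi> * cnj (P \<xi>))) = (\<Sum>l\<in>L. \<Sum>l'\<in>L. f (l - l'))"
      using Wg[of "\<lambda>\<xi>. cis (2 * pi * (\<xi> \<bullet> _))" 1] by (simp add: fw W_def[symmetric])
    also have "\<dots> = (\<Sum>l\<in>L. \<Sum>l'\<in>L. if l' = l then f 0 else 0)"
      using pack by (intro sum.cong) auto
    finally show ?thesis using L by simp
  qed
  have PD: "(LINT \<xi>|lborel. W \<xi> * (P \<xi> * cnj (D \<xi>))) = of_nat (card L) * (LINT x|lborel. f x)"
  proof -
    have "(LINT \<xi>|lborel. W \<xi> * (P \<xi> * cis (- (2 * pi * (\<xi> \<bullet> y))))) = (\<Sum>l\<in>L. f (l - y))" for y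
    proof -
      have "W \<xi> * (P \<xi> * cis (- (2 * pi * (\<xi> \<bullet> y)))) = (\<Sum>l\<in>L. W \<xi> * cis (2 * pi * (\<xi> \<bullet> (l - y))))" for \<xi>
        unfolding P_def sum_distrib_left sum_distrib_right
        by (simp add: cis_mult inner_diff_right algebra_simps)
      then show ?thesis
        using Wg[of "\<lambda>\<xi>. cis (2 * pi * (\<xi> \<bullet> _))" 1] by (simp add: fw W_def[symmetric])
    qed
    then have "(LINT \<xi>|lborel. W \<xi> * (P \<xi> * cnj (D \<xi>))) = (LINT y|lborel. (\<Sum>l\<in>L. Q y * f (l - y)))"
      by (subst WD[OF _ Pb]) (auto simp: sum_distrib_left)
    also have "\<dots> = (\<Sum>l\<in>L. LINT y|lborel. Q y * f (l - y))"
    proof (intro Bochner_Integration.integral_sum)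
      fix l
      show "integrable lborel (\<lambda>y. Q y * f (l - y))"
        by (rule Bochner_Integration.integrable_bound[OF lborel_integrable_scaleR[OF _ int, of "-1" l]])
          (auto simp: Q_def norm_mult indicator_def)
    qed
    also have "\<dots> = (\<Sum>l\<in>L. LINT x|lborel. f x)"
      using L by (intro sum.cong refl Qf) auto
    finally show ?thesis by simp
  qed
  \<comment> \<open>A further exchange of integrals; together with \<open>WD\<close> it turns the
    last term of the square into the integral of \<open>Q y * J y\<close>.\<close>
  have DJ: "(LINT \<xi>|lborel. W \<xi> * (D \<xi> * cis (- (2 * pi * (\<xi> \<bullet> y))))) = J y" for y
  proof -
    have "(LINT \<xi>|lborel. (W \<xi> * cis (- (2 * pi * (\<xi> \<bullet> y)))) * (LINT x|lborel. Q x * cis (2 * pi * (\<xi> \<bullet> x))))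
      = (LINT x|lborel. Q x * (LINT \<xi>|lborel. (W \<xi> * cis (- (2 * pi * (\<xi> \<bullet> y)))) * cis (2 * pi * (\<xi> \<bullet> x))))"
      by (intro Fubini_kernel Qi Wg[of _ 1]) (auto simp: split_beta)
    moreover have "(W \<xi> * cis (- (2 * pi * (\<xi> \<bullet> y)))) * cis (2 * pi * (\<xi> \<bullet> x)) = W \<xi> * cis (2 * pi * (\<xi> \<bullet> (x - y)))" for x \<xi>
      by (simp add: mult.assoc cis_mult inner_diff_right algebra_simps)
    moreover have "W \<xi> * (D \<xi> * cis (- (2 * pi * (\<xi> \<bullet> y)))) = (W \<xi> * cis (- (2 * pi * (\<xi> \<bullet> y)))) * D \<xi>" for \<xi>
      by simp
    ultimately show ?thesis
      unfolding J_def fw W_def[symmetric] by (simp only: D_def)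
  qed
  have QJ: "integrable lborel (\<lambda>y. Q y * J y)"
  proof (rule Bochner_Integration.integrable_bound)
    show "integrable lborel (\<lambda>y. of_real K * Q y)" using Qi by simp
    show "AE y in lborel. norm (Q y * J y) \<le> norm (of_real K * Q y)"
      using JK by (auto simp: norm_mult Q_def indicator_def intro!: order.trans[OF JK])
  qed measurable
  have DD: "Re (LINT \<xi>|lborel. W \<xi> * (D \<xi> * cnj (D \<xi>)))
      \<le> K * measure lborel (ball (0::'a) (r + a)) - (K - I) * measure lborel (ball (0::'a) r)"
  proof -
    have ball_int: "integrable lborel (indicator (ball (0::'a) s) :: 'a \<Rightarrow> real)" for s
      by (intro integrable_real_indicator emeasure_bounded_finite) auto
    have "Re (LINT \<xi>|lborel. W \<xi> * (D \<xi> * cnj (D \<xi>))) = Re (LINT y|lborel. Q y * J y)"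
      by (subst WD[OF _ Db]) (simp_all add: DJ)
    also have "\<dots> = (LINT y|lborel. Re (Q y * J y))"
      by (rule integral_Re[symmetric, OF QJ])
    \<comment> \<open>The majorant is \<open>I\<close>, the exact value of \<open>Re (J y)\<close>,
      on the inner ball, and the crude bound \<open>K\<close> on the shell between the radii
      \<open>r\<close> and \<open>r + a\<close>.\<close>
    also have "\<dots> \<le> (LINT y|lborel. K * indicator (ball 0 (r + a)) y - (K - I) * indicator (ball (0::'a) r) y)"
    proof (rule integral_mono)
      fix y :: 'a
      have "Re (J y) \<le> K" using JK[of y] complex_Re_le_cmod[of "J y"] by linarith
      moreover have "Re (J y) = I" if "norm y < r" using Jf[OF that] by (simp add: I_def)
      ultimately show "Re (Q y * J y) \<le> K * indicator (ball 0 (r + a)) y - (K - I) * indicator (ball 0 r) y"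
        using a by (auto simp: Q_def indicator_def)
    qed (use QJ ball_int in \<open>auto intro!: Bochner_Integration.integrable_diff simp del: times_complex.simps\<close>)
    also have "\<dots> = K * measure lborel (ball (0::'a) (r + a)) - (K - I) * measure lborel (ball (0::'a) r)"
      using ball_int by (subst Bochner_Integration.integral_diff) auto
    finally show ?thesis .
  qed
  \<comment> \<open>The two cross terms of the square are conjugate to each other, so in the real
    part they are replaced by twice one of them.\<close>
  define h where "h \<xi> = W \<xi> * (P \<xi> * cnj (P \<xi>)) - of_real (2 * c) * (W \<xi> * (P \<xi> * cnj (D \<xi>)))
     + of_real (c\<^sup>2) * (W \<xi> * (D \<xi> * cnj (D \<xi>)))" for \<xi>
  have Wpq: "integrable lborel (\<lambda>\<xi>. W \<xi> * (p \<xi> * cnj (q \<xi>)))"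
    if "p \<in> borel_measurable borel" "\<And>\<xi>. norm (p \<xi>) \<le> A"
      and "q \<in> borel_measurable borel" "\<And>\<xi>. norm (q \<xi>) \<le> B" for p q A B
  proof (rule Wg)
    show "(\<lambda>\<xi>. p \<xi> * cnj (q \<xi>)) \<in> borel_measurable borel"
      using that(1) borel_measurable_continuous_on[OF continuous_on_cnj[OF continuous_on_id] that(3)]
      by measurable
    show "norm (p \<xi> * cnj (q \<xi>)) \<le> A * B" for \<xi>
      unfolding norm_mult complex_mod_cnj
      using that(2,4)[of \<xi>] order.trans[OF norm_ge_zero that(2)] by (intro mult_mono) auto
  qed
  note i = Wpq[OF _ Pb _ Pb] Wpq[OF _ Pb _ Db] Wpq[OF _ Db _ Db]
  have "Re (h \<xi>) = w \<xi> * (norm (P \<xi> - of_real c * D \<xi>))\<^sup>2" for \<xi>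
    unfolding h_def W_def cmod_power2 by (simp add: power2_eq_square algebra_simps)
  then have "0 \<le> (LINT \<xi>|lborel. Re (h \<xi>))" using w by simp
  also have "\<dots> = Re (LINT \<xi>|lborel. h \<xi>)"
    unfolding h_def using i by (intro integral_Re) auto
  also have "(LINT \<xi>|lborel. h \<xi>) = of_nat (card L) * f 0 - of_real (2 * c) * (of_nat (card L) * (LINT x|lborel. f x))
     + of_real (c\<^sup>2) * (LINT \<xi>|lborel. W \<xi> * (D \<xi> * cnj (D \<xi>)))"
    unfolding h_def using i by (simp add: PP PD)
  finally have "0 \<le> card L * Re (f 0) - 2 * c * card L * I + c\<^sup>2 * Re (LINT \<xi>|lborel. W \<xi> * (D \<xi> * cnj (D \<xi>)))"
    by (simp add: I_def)
  also have "\<dots> \<le> card L * Re (f 0) - 2 * c * card L * I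
     + c\<^sup>2 * (K * measure lborel (ball (0::'a) (r + a)) - (K - I) * measure lborel (ball (0::'a) r))"
    using DD by (intro add_left_mono mult_left_mono) auto
  finally show ?thesis .
qed

subsection \<open>The extremal function\<close>

text \<open>For \<open>H\<close> equal to half of \<Omega> this is the extremal function without its
  normalising factor.\<close>

definition autoconv :: "'a::euclidean_space set \<Rightarrow> 'a \<Rightarrow> complex" where
  "autoconv H x = (LINT y|lborel. indicator H y * indicator H (x - y))"

lemma borel_measurable_indicator_complex:
  "H \<in> sets borel \<Longrightarrow> (indicator H :: 'a::euclidean_space \<Rightarrow> complex) \<in> borel_measurable borel"
  by (intro borel_measurable_indicator) simp

lemma borel_measurable_autoconv:
  assumes "H \<in> sets borel"
  shows "autoconv H \<in> borel_measurable borel"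
proof -
  note [measurable] = borel_measurable_indicator_complex[OF assms]
  show ?thesis unfolding autoconv_def[abs_def] by measurable
qed

lemma autoconv_nonzero_imp:
  fixes H :: "'a::euclidean_space set"
  assumes "autoconv H x \<noteq> 0"
  obtains y z where "y \<in> H" "z \<in> H" "x = y + z"
proof -
  have "\<exists>y. y \<in> H \<and> x - y \<in> H"
  proof (rule ccontr)
    assume "\<nexists>y. y \<in> H \<and> x - y \<in> H"
    then have "autoconv H x = (LINT y|(lborel :: 'a measure). 0)"
      unfolding autoconv_def by (intro Bochner_Integration.integral_cong) (auto simp: indicator_def)
    then show False using assms by simp
  qed
  then show thesis using that by force
qed

lemma integrable_indicator_bounded:
  assumes "H \<in> sets borel" "bounded H"
  shows "integrable lborel (indicator H :: 'a::euclidean_space \<Rightarrow> complex)"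
  using assms by (intro integrable_indicator_complex emeasure_bounded_finite) auto

lemma norm_autoconv_le:
  assumes "H \<in> sets borel" "bounded H"
  shows "norm (autoconv H x) \<le> measure lborel (H :: 'a::euclidean_space set)"
proof -
  have "norm (autoconv H x) \<le> (LINT y|lborel. indicator H y)"
    unfolding autoconv_def
    by (rule order.trans[OF integral_norm_bound], rule integral_mono')
       (use assms in \<open>auto intro!: integrable_real_indicator emeasure_bounded_finite simp: norm_mult split: split_indicator\<close>)
  then show ?thesis using assms by simp
qed

text \<open>If \<open>H\<close> lies in the ball of radius \<open>R\<close>, the function is bounded
  by the measure of \<open>H\<close> and vanishes outside the ball of radius
  \<open>2 * R\<close>.\<close>

lemma integrable_autoconv:
  assumes H: "H \<in> sets borel" "bounded (H :: 'a::euclidean_space set)"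
  shows "integrable lborel (autoconv H)"
proof -
  obtain R where R: "H \<subseteq> ball 0 R" using H(2) by (meson bounded_subset_ballD)
  show ?thesis
  proof (rule Bochner_Integration.integrable_bound)
    show "integrable lborel (\<lambda>x::'a. complex_of_real (measure lborel H) * indicator (ball 0 (2 * R)) x)"
      by (intro integrable_mult_right integrable_indicator_bounded) auto
    have "norm (autoconv H x) \<le> norm (complex_of_real (measure lborel H) * indicator (ball 0 (2 * R)) x)" for x
    proof (cases "autoconv H x = 0")
      case False
      then obtain y z where "y \<in> H" "z \<in> H" "x = y + z" by (rule autoconv_nonzero_imp)
      moreover from this have "norm y < R" "norm z < R" using R by auto
      ultimately have "norm x < 2 * R" using norm_triangle_ineq[of y z] by simp
      then show ?thesis using norm_autoconv_le[OF H] by (simp add: norm_mult)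
    qed auto
    then show "AE x in lborel. norm (autoconv H x) \<le> norm (complex_of_real (measure lborel H) * indicator (ball 0 (2 * R)) x)"
      by auto
  qed (use borel_measurable_autoconv[OF H(1)] in simp)
qed

text \<open>The convolution theorem. The indicator \<open>b\<close> of a ball containing all sums of
  two points of \<open>H\<close> can be inserted freely by \<open>bh\<close>; it supplies the
  integrable factor in \<open>x\<close> that \<open>Fubini_kernel\<close> asks for, and is removed
  again after the exchange.\<close>

lemma char_transform_autoconv:
  assumes H: "H \<in> sets borel" "bounded (H :: 'a::euclidean_space set)"
  shows "char_transform (autoconv H) \<xi> = (char_transform (indicator H) \<xi>)\<^sup>2"
proof -
  define h where "h = (indicator H :: 'a \<Rightarrow> complex)"
  have hi: "integrable lborel h" unfolding h_def by (rule integrable_indicator_bounded[OF H])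
  have [measurable]: "h \<in> borel_measurable borel"
    using hi by auto
  have h_le: "norm (h x) \<le> 1" for x by (simp add: h_def indicator_def)
  obtain R where R: "H \<subseteq> ball 0 R" using H(2) by (meson bounded_subset_ballD)
  define b where "b = (indicator (ball 0 (2 * R)) :: 'a \<Rightarrow> complex)"
  have bi: "integrable lborel b" unfolding b_def by (rule integrable_indicator_bounded) auto
  have bh: "h y * (b x * h (x - y)) = h y * h (x - y)" for x y
  proof (cases "y \<in> H \<and> x - y \<in> H")
    case True
    then have "norm y < R" "norm (x - y) < R" using R by auto
    then have "norm x < 2 * R" using norm_triangle_ineq[of y "x - y"] by simp
    then show ?thesis by (simp add: b_def)
  qed (auto simp: h_def)
  have "char_transform (autoconv H) \<xi> = (LINT x|lborel. b x * (LINT y|lborel. h y * (h (x - y) * cis (- (2 * pi * (\<xi> \<bullet> x))))))"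
    unfolding char_transform_def
  proof (intro Bochner_Integration.integral_cong refl)
    fix x
    have "autoconv H x * cis (- (2 * pi * (\<xi> \<bullet> x))) = (LINT y|lborel. h y * h (x - y) * cis (- (2 * pi * (\<xi> \<bullet> x))))"
      by (simp add: autoconv_def h_def)
    also have "\<dots> = (LINT y|lborel. b x * (h y * (h (x - y) * cis (- (2 * pi * (\<xi> \<bullet> x))))))"
      by (intro Bochner_Integration.integral_cong refl, subst bh[symmetric]) (simp add: mult_ac)
    finally show "autoconv H x * cis (- (2 * pi * (\<xi> \<bullet> x))) = b x * (LINT y|lborel. h y * (h (x - y) * cis (- (2 * pi * (\<xi> \<bullet> x)))))"
      by simp
  qed
  also have "\<dots> = (LINT y|lborel. h y * (LINT x|lborel. b x * (h (x - y) * cis (- (2 * pi * (\<xi> \<bullet> x))))))"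
    by (intro Fubini_kernel bi hi) (auto simp: split_beta norm_mult h_le)
  also have "\<dots> = (LINT y|lborel. h y * (cis (- (2 * pi * (\<xi> \<bullet> y))) * char_transform h \<xi>))"
  proof (intro Bochner_Integration.integral_cong refl)
    fix y
    have "h y * (LINT x|lborel. b x * (h (x - y) * cis (- (2 * pi * (\<xi> \<bullet> x)))))
       = h y * (LINT x|lborel. h (x - y) * cis (- (2 * pi * (\<xi> \<bullet> x))))"
      unfolding integral_mult_right_zero[symmetric]
      by (intro Bochner_Integration.integral_cong refl, subst (2) mult.assoc[symmetric], subst bh[symmetric]) (simp add: mult_ac)
    also have "(LINT x|lborel. h (x - y) * cis (- (2 * pi * (\<xi> \<bullet> x))))
       = (LINT x|lborel. h x * cis (- (2 * pi * (\<xi> \<bullet> (x + y)))))"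
      using lborel_integral_shift[of "\<lambda>x. h x * cis (- (2 * pi * (\<xi> \<bullet> (x + y))))" y] by simp
    also have "\<dots> = (LINT x|lborel. cis (- (2 * pi * (\<xi> \<bullet> y))) * (h x * cis (- (2 * pi * (\<xi> \<bullet> x)))))"
      by (intro Bochner_Integration.integral_cong refl)
        (simp add: inner_add_right mult.left_commute[of "cis _" "h _"] cis_mult algebra_simps)
    also have "\<dots> = cis (- (2 * pi * (\<xi> \<bullet> y))) * char_transform h \<xi>"
      by (simp add: char_transform_def)
    finally show "h y * (LINT x|lborel. b x * (h (x - y) * cis (- (2 * pi * (\<xi> \<bullet> x)))))
       = h y * (cis (- (2 * pi * (\<xi> \<bullet> y))) * char_transform h \<xi>)" .
  qed
  also have "\<dots> = (char_transform h \<xi>)\<^sup>2"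
    unfolding mult.assoc[symmetric] integral_mult_left_zero
    by (simp add: char_transform_def power2_eq_square)
  finally show ?thesis by (simp add: h_def)
qed

text \<open>Conjugation reverses the sign of the frequency, and the reflection of the variable
  restores it, so the transform equals its conjugate.\<close>

lemma Im_char_transform_symmetric:
  assumes "H \<in> sets borel" "bounded (H :: 'a::euclidean_space set)" and sym: "\<And>x. - x \<in> H \<longleftrightarrow> x \<in> H"
  shows "Im (char_transform (indicator H) \<xi>) = 0"
proof -
  note [measurable] = borel_measurable_indicator_complex[OF assms(1)]
  have "cnj (char_transform (indicator H) \<xi>) = (LINT x|lborel. indicator H x * cis (2 * pi * (\<xi> \<bullet> x)))"
    unfolding char_transform_def Bochner_Integration.integral_cnj[symmetric]
    by (intro Bochner_Integration.integral_cong) (auto simp: indicator_def cis_cnj)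
  also have "\<dots> = (LINT x|lborel. indicator H (0 - x) * cis (2 * pi * (\<xi> \<bullet> (0 - x))))"
    by (subst lborel_integral_reflect) auto
  also have "\<dots> = char_transform (indicator H) \<xi>"
    unfolding char_transform_def
    by (intro Bochner_Integration.integral_cong) (auto simp: indicator_def sym)
  finally show ?thesis by (simp add: complex_eq_iff)
qed

lemma char_transform_0: "char_transform f 0 = (LINT x|lborel. f x)"
  by (simp add: char_transform_def)

lemma integral_indicator_complex:
  assumes "H \<in> sets borel"
  shows "(LINT x|lborel. indicator H x) = complex_of_real (measure lborel (H :: 'a::euclidean_space set))"
proof -
  have "(LINT x|lborel. complex_of_real (indicator H x)) = complex_of_real (measure lborel H)"
    using assms unfolding integral_complex_of_real by simp
  then show ?thesis by (simp add: of_real_indicator)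
qed

text \<open>If \<open>x - y\<close> is off the frontier of \<open>H\<close>, then
  \<open>X n - y\<close> is eventually on the same side of it as \<open>x - y\<close>. The frontier
  of a convex set is null, so the integrands converge almost everywhere, dominated by the indicator
  of \<open>H\<close>.\<close>

lemma continuous_autoconv:
  assumes H: "open H" "bounded H" "convex (H :: 'a::euclidean_space set)"
  shows "continuous_on UNIV (autoconv H)"
proof -
  have Hb: "H \<in> sets borel" using H by auto
  note [measurable] = borel_measurable_indicator_complex[OF Hb]
  have "(\<lambda>n. autoconv H (X n)) \<longlonglongrightarrow> autoconv H x" if X: "X \<longlonglongrightarrow> x" for X x
    unfolding autoconv_def
  proof (rule integral_dominated_convergence[where w = "indicator H"])
    show "integrable lborel (indicator H :: 'a \<Rightarrow> real)"
      using H Hb by (intro integrable_real_indicator emeasure_bounded_finite) auto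
    have "negligible ((-) x ` frontier H)"
      using negligible_convex_frontier[OF H(3)]
      by (intro negligible_differentiable_image_negligible) auto
    then have "AE y in lebesgue. y \<notin> (-) x ` frontier H"
      by (intro AE_not_in) (simp add: negligible_iff_null_sets)
    then have ae: "AE y in lborel. y \<notin> (-) x ` frontier H"
      unfolding AE_completion_iff .
    then show "AE y in lborel. (\<lambda>n. indicator H y * indicator H (X n - y)) \<longlonglongrightarrow> (indicator H y * indicator H (x - y) :: complex)"
    proof eventually_elim
      case (elim y)
      then have nf: "x - y \<notin> frontier H" by (metis (no_types) diff_diff_eq2 add_diff_cancel_left' image_eqI)
      have lim: "(\<lambda>n. X n - y) \<longlonglongrightarrow> x - y" using X by (intro tendsto_intros)
      have "\<forall>\<^sub>F n in sequentially. (X n - y \<in> H) = (x - y \<in> H)"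
      proof (cases "x - y \<in> H")
        case True
        then show ?thesis using topological_tendstoD[OF lim H(1)] by simp
      next
        case False
        then have "x - y \<in> - closure H" using nf H(1) by (auto simp: frontier_def interior_open)
        moreover have "open (- closure H)" by auto
        ultimately have "\<forall>\<^sub>F n in sequentially. X n - y \<in> - closure H" using lim by (auto dest: topological_tendstoD)
        then show ?thesis
          by eventually_elim (use False closure_subset in auto)
      qed
      then have "\<forall>\<^sub>F n in sequentially. indicator H y * indicator H (X n - y) = (indicator H y * indicator H (x - y) :: complex)"
        by eventually_elim (auto simp: indicator_def)
      then show ?case by (rule tendsto_eventually)
    qed
  qed (auto simp: norm_mult split: split_indicator)
  then show ?thesis
    by (intro continuous_at_imp_continuous_on) (auto simp: continuous_at_sequentially o_def)
qed

lemma fourier_eq_char_transform: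
  assumes "f \<in> borel_measurable borel"
  shows "fourier f \<xi> = char_transform f \<xi>"
proof -
  note [measurable] = assms
  have "exp (- (2 * of_real pi * \<i> * of_real (\<xi> \<bullet> x))) = cis (- (2 * pi * (\<xi> \<bullet> x)))" for x
    by (simp add: cis_conv_exp algebra_simps)
  then show ?thesis unfolding fourier_def char_transform_def by (simp add: integral_completion)
qed

lemma measure_pos_open:
  assumes "open S" "bounded S" "S \<noteq> ({} :: 'a::euclidean_space set)"
  shows "0 < measure lborel S"
proof -
  obtain x e where "e > 0" "ball x e \<subseteq> S" using assms by (metis open_contains_ball ex_in_conv)
  moreover have "measure lborel (ball x e) \<le> measure lborel S"
    using assms calculation by (intro measure_mono_fmeasurable) (auto intro!: fmeasurableI emeasure_bounded_finite)
  ultimately show ?thesis using content_ball_gt_0_iff[of x e] by linarith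
qed

text \<open>The transform is a positive constant times the square of a real number, hence
  nonnegative. The measure of \<open>H\<close> is \<open>1 / k\<close>, which yields the value 1 at
  the origin and the integral \<open>1 / k\<close>.\<close>

lemma turan_extremal:
  fixes \<Omega> :: "(real ^ 'd) set"
  assumes \<Omega>: "open \<Omega>" "\<Omega> \<noteq> {}" "bounded \<Omega>" "convex \<Omega>" "symmetric_set \<Omega>"
  shows turan_extremal_admissible: "turan_admissible \<Omega> (turan_extremal \<Omega>)"
    and integral_turan_extremal: "(LINT x|lebesgue. turan_extremal \<Omega> x) = of_real (measure lebesgue \<Omega> / 2 ^ CARD('d))"
proof -
  define H where "H = (*\<^sub>R) (1/2) ` \<Omega>"
  have H: "open H" "bounded H" "convex H"
    unfolding H_def using \<Omega> by (auto intro: open_scaling bounded_scaling convex_scaling)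
  then have Hb: "H \<in> sets borel" by auto
  note [measurable] = borel_measurable_indicator_complex[OF Hb] borel_measurable_autoconv[OF Hb]
  have inH: "x \<in> H \<longleftrightarrow> 2 *\<^sub>R x \<in> \<Omega>" for x
    unfolding H_def by (auto simp: image_iff intro!: bexI[of _ "2 *\<^sub>R x"])
  have sym: "- x \<in> \<Omega> \<longleftrightarrow> x \<in> \<Omega>" for x
    using \<Omega>(5) unfolding symmetric_set_def by (metis image_iff minus_minus)
  then have symH: "- x \<in> H \<longleftrightarrow> x \<in> H" for x using sym[of "2 *\<^sub>R x"] by (simp add: inH)
  define m where "m = measure lebesgue \<Omega>"
  have m: "0 < m"
    using measure_pos_open[OF \<Omega>(1,3,2)] \<Omega>(1) by (auto simp: m_def measure_completion)
  have mH: "measure lborel H = m / 2 ^ CARD('d)"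
    using measure_lebesgue_affine[of "1/2" 0 \<Omega>] Hb \<Omega>(1)
    by (simp add: H_def[symmetric] measure_completion m_def power_divide)
  define k where "k = 2 ^ CARD('d) / m"
  have k: "k > 0" using m by (simp add: k_def)
  have conv: "Defs.convolution (indicator H) (indicator H) x = autoconv H x" for x
    unfolding Defs.convolution_def autoconv_def by (subst integral_completion) auto
  have ext: "turan_extremal \<Omega> = (\<lambda>x. of_real k * autoconv H x)"
    unfolding turan_extremal_def[abs_def] conv[unfolded H_def] k_def m_def H_def ..
  have [measurable]: "turan_extremal \<Omega> \<in> borel_measurable borel" unfolding ext by measurable
  have ft: "fourier (turan_extremal \<Omega>) \<xi> = of_real k * (char_transform (indicator H) \<xi>)\<^sup>2" for \<xi>
    unfolding char_transform_autoconv[OF Hb H(2), symmetric]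
    by (subst fourier_eq_char_transform) (simp_all add: ext char_transform_def mult.assoc)
  have im: "Im (char_transform (indicator H) \<xi>) = 0" for \<xi>
    by (rule Im_char_transform_symmetric[OF Hb H(2) symH])
  have "positive_definite (turan_extremal \<Omega>)"
    unfolding positive_definite_def
  proof (intro conjI allI)
    show "continuous_on UNIV (turan_extremal \<Omega>)"
      unfolding ext by (intro continuous_intros continuous_autoconv H)
    show "integrable lebesgue (turan_extremal \<Omega>)"
      by (subst integrable_completion) (simp_all add: ext integrable_autoconv[OF Hb H(2)])
    show "Im (fourier (turan_extremal \<Omega>) \<xi>) = 0" "0 \<le> Re (fourier (turan_extremal \<Omega>) \<xi>)" for \<xi>
      using k im[of \<xi>] unfolding ft by (auto simp: power2_eq_square)
  qed
  moreover have "supported_in (turan_extremal \<Omega>) \<Omega>"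
    unfolding supported_in_def
  proof (intro allI impI, rule ccontr)
    fix x assume x: "x \<notin> \<Omega>" "turan_extremal \<Omega> x \<noteq> 0"
    then have "autoconv H x \<noteq> 0" by (auto simp: ext)
    then obtain y z where "y \<in> H" "z \<in> H" "x = y + z" by (rule autoconv_nonzero_imp)
    \<comment> \<open>A sum of two points of \<open>H\<close> is the midpoint of their doubles,
      which belong to the convex set \<Omega>.\<close>
    then have "(1/2) *\<^sub>R (2 *\<^sub>R y) + (1/2) *\<^sub>R (2 *\<^sub>R z) \<in> \<Omega>"
      by (intro convexD[OF \<Omega>(4)]) (auto simp: inH)
    then show False using x \<open>x = y + z\<close> by simp
  qed
  moreover have "turan_extremal \<Omega> 0 = 1"
  proof -
    \<comment> \<open>By symmetry of \<open>H\<close> both indicators in the integrand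
      coincide.\<close>
    have "autoconv H 0 = (LINT y|lborel. indicator H y)"
      unfolding autoconv_def by (intro Bochner_Integration.integral_cong) (auto simp: indicator_def symH)
    then show ?thesis using m unfolding ext
      by (simp add: integral_indicator_complex[OF Hb] mH k_def)
  qed
  ultimately show "turan_admissible \<Omega> (turan_extremal \<Omega>)" by (simp add: turan_admissible_def)
  have "(LINT x|lebesgue. turan_extremal \<Omega> x) = fourier (turan_extremal \<Omega>) 0" by (simp add: fourier_def)
  also have "\<dots> = of_real (m / 2 ^ CARD('d))"
    unfolding ft char_transform_0 integral_indicator_complex[OF Hb] mH using m
    by (simp add: k_def power2_eq_square)
  finally show "(LINT x|lebesgue. turan_extremal \<Omega> x) = of_real (measure lebesgue \<Omega> / 2 ^ CARD('d))" by (simp add: m_def)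
qed

subsection \<open>Counting tiles\<close>

text \<open>An overlap of two open tiles is open; if nonempty it has positive measure, against
  almost everywhere uniqueness.\<close>

lemma translational_tile_disjoint:
  fixes \<Omega> :: "(real ^ 'd) set"
  assumes op: "open \<Omega>" and ae: "AE x in lebesgue. \<exists>!l. l \<in> L \<and> x \<in> (\<lambda>y. y + l) ` \<Omega>"
    and l: "l \<in> L" "l' \<in> L" "l \<noteq> l'"
  shows "(\<lambda>y. y + l) ` \<Omega> \<inter> (\<lambda>y. y + l') ` \<Omega> = {}"
proof (rule ccontr)
  define U where "U = (\<lambda>y. y + l) ` \<Omega> \<inter> (\<lambda>y. y + l') ` \<Omega>"
  assume "\<not> ?thesis"
  then have "U \<noteq> {}" by (simp add: U_def)
  have "open U"
    using open_translation[OF op, of l] open_translation[OF op, of l'] by (auto simp: U_def add.commute cong: image_cong_simp)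
  have "AE x in lebesgue. x \<notin> U"
    using ae by eventually_elim (use l in \<open>auto simp: U_def\<close>)
  then have "U \<in> null_sets lebesgue"
    using \<open>open U\<close> by (subst (asm) AE_iff_null_sets[symmetric]) auto
  then show False
    using open_not_negligible[OF \<open>open U\<close> \<open>U \<noteq> {}\<close>] by (simp add: negligible_iff_null_sets)
qed

text \<open>If half the difference \<open>v\<close> were in \<Omega>, so would be
  \<open>- v\<close>, and \<open>- v + l = v + l'\<close> would lie in two different tiles.\<close>

lemma translational_tile_half_difference:
  fixes \<Omega> :: "(real ^ 'd) set"
  assumes "open \<Omega>" "AE x in lebesgue. \<exists>!l. l \<in> L \<and> x \<in> (\<lambda>y. y + l) ` \<Omega>"
    and "l \<in> L" "l' \<in> L" "l \<noteq> l'" and sym: "\<And>x. x \<in> \<Omega> \<Longrightarrow> - x \<in> \<Omega>"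
  shows "(1/2) *\<^sub>R (l - l') \<notin> \<Omega>"
proof
  define v where "v = (1/2) *\<^sub>R (l - l')"
  assume "(1/2) *\<^sub>R (l - l') \<in> \<Omega>"
  then have v: "v \<in> \<Omega>" "- v \<in> \<Omega>" using sym by (auto simp: v_def)
  have "l - l' = v + v" by (simp add: v_def flip: scaleR_left_distrib)
  then have "- v + l = v + l'" by (simp add: algebra_simps)
  then have "v + l' \<in> (\<lambda>y. y + l) ` \<Omega> \<inter> (\<lambda>y. y + l') ` \<Omega>"
    using v by (metis IntI image_eqI)
  then show False using translational_tile_disjoint[OF assms(1-5)] by auto
qed

text \<open>Tiles with translation vector in the ball of radius \<open>R\<close> are disjoint and
  stay inside radius \<open>R + a\<close>; conversely, every tile meeting the ball of radius
  \<open>R - a\<close> has its vector in the ball of radius \<open>R\<close>. Comparing volumes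
  gives both bounds.\<close>

lemma translational_tile_count:
  fixes \<Omega> :: "(real ^ 'd) set"
  assumes \<Omega>: "open \<Omega>" "\<Omega> \<noteq> {}" "\<Omega> \<subseteq> ball 0 a"
    and ae: "AE x in lebesgue. \<exists>!l. l \<in> L \<and> x \<in> (\<lambda>y. y + l) ` \<Omega>"
  shows finite_translational_tile_ball: "finite (L \<inter> ball 0 R)"
    and translational_tile_count_le: "card (L \<inter> ball 0 R) * measure lebesgue \<Omega> \<le> measure lebesgue (ball (0 :: real ^ 'd) (R + a))"
    and translational_tile_count_ge: "measure lebesgue (ball (0 :: real ^ 'd) (R - a)) \<le> card (L \<inter> ball 0 R) * measure lebesgue \<Omega>"
proof -
  define T where "T l = (\<lambda>y. y + l) ` \<Omega>" for l
  have bd: "bounded \<Omega>" using \<Omega>(3) bounded_ball bounded_subset by blast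
  have T_open: "open (T l)" for l
    using open_translation[OF \<Omega>(1), of l] by (simp add: T_def add.commute cong: image_cong_simp)
  have T_bd: "bounded (T l)" for l
    using bounded_translation[OF bd, of l] by (simp add: T_def add.commute cong: image_cong_simp)
  have T_lm: "T l \<in> lmeasurable" for l
    using T_open T_bd by (intro lmeasurable_open)
  have T_m: "measure lebesgue (T l) = measure lebesgue \<Omega>" for l
    using measure_lebesgue_affine[of 1 l \<Omega>] by (simp add: T_def)
  have m: "0 < measure lebesgue \<Omega>"
    using measure_pos_open[OF \<Omega>(1) bd \<Omega>(2)] \<Omega>(1) by (simp add: measure_completion)
  have Tn: "norm (x - l) < a" if "x \<in> T l" for x l
    using that \<Omega>(3) by (auto simp: T_def)
  have union: "measure lebesgue (\<Union>l\<in>F. T l) = card F * measure lebesgue \<Omega>" if "finite F" "F \<subseteq> L" for F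
  proof -
    have "disjoint_family_on T F"
      using translational_tile_disjoint[OF \<Omega>(1) ae] that by (auto simp: disjoint_family_on_def T_def)
    then have "measure lebesgue (\<Union>l\<in>F. T l) = (\<Sum>l\<in>F. measure lebesgue (T l))"
      using T_lm that by (intro measure_finite_Union)
        (auto simp: fmeasurable_def less_top simp del: emeasure_completion)
    then show ?thesis by (simp add: T_m)
  qed
  have le: "card F * measure lebesgue \<Omega> \<le> measure lebesgue (ball (0 :: real ^ 'd) (R + a))"
    if F: "finite F" "F \<subseteq> L \<inter> ball 0 R" for F
  proof -
    have "(\<Union>l\<in>F. T l) \<subseteq> ball 0 (R + a)"
    proof (safe; simp)
      fix l x assume "l \<in> F" "x \<in> T l"
      then have "norm l < R" "norm (x - l) < a" using Tn F by auto
      then show "norm x < R + a" using norm_triangle_ineq[of l "x - l"] by simp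
    qed
    then have "measure lebesgue (\<Union>l\<in>F. T l) \<le> measure lebesgue (ball (0 :: real ^ 'd) (R + a))"
      using open_UN[of F T] T_open by (intro measure_mono_fmeasurable) auto
    then show ?thesis using union[of F] F by simp
  qed
  show fin: "finite (L \<inter> ball 0 R)"
  \<comment> \<open>The volume bound holds for each finite subset with the same right-hand side,
    which excludes an infinite set.\<close>
  proof (rule finite_if_finite_subsets_card_bdd[THEN conjunct1])
    fix F assume F: "F \<subseteq> L \<inter> ball 0 R" "finite F"
    have "card F \<le> measure lebesgue (ball (0 :: real ^ 'd) (R + a)) / measure lebesgue \<Omega>"
      using le[OF F(2,1)] m by (simp add: pos_le_divide_eq)
    then show "card F \<le> nat \<lfloor>measure lebesgue (ball (0 :: real ^ 'd) (R + a)) / measure lebesgue \<Omega>\<rfloor>"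
      by linarith
  qed
  show "card (L \<inter> ball 0 R) * measure lebesgue \<Omega> \<le> measure lebesgue (ball (0 :: real ^ 'd) (R + a))"
    by (rule le[OF fin]) auto
  let ?U = "\<Union>l\<in>L \<inter> ball 0 R. T l"
  have "AE x in lebesgue. x \<in> ball 0 (R - a) \<longrightarrow> x \<in> ?U"
    using ae
  proof eventually_elim
    case (elim x)
    then obtain l where l: "l \<in> L" "x \<in> T l" by (auto simp: T_def)
    then have "norm l < R" if "norm x < R - a"
      using that Tn[OF l(2)] norm_triangle_ineq4[of x "x - l"] by simp
    with l show ?case by auto
  qed
  then have "emeasure lebesgue (ball (0 :: real ^ 'd) (R - a)) \<le> emeasure lebesgue ?U"
    using open_UN[of "L \<inter> ball 0 R" T] T_open by (intro emeasure_mono_AE) auto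
  moreover have "?U \<in> lmeasurable" using fin T_lm by (intro fmeasurable.finite_UN) auto
  ultimately have "measure lebesgue (ball (0 :: real ^ 'd) (R - a)) \<le> measure lebesgue ?U"
    unfolding measure_def by (intro enn2real_mono) (auto simp: fmeasurable_def)
  then show "measure lebesgue (ball (0 :: real ^ 'd) (R - a)) \<le> card (L \<inter> ball 0 R) * measure lebesgue \<Omega>"
    using union[OF fin] by simp
qed

section \<open>The upper bound for the integral when \<Omega> is a tile\<close>

lemma turan_integral_le:
  fixes \<Omega> :: "(real ^ 'd) set"
  assumes \<Omega>: "open \<Omega>" "\<Omega> \<noteq> {}" "bounded \<Omega>" "symmetric_set \<Omega>" "translational_tile \<Omega>"
    and f: "turan_admissible \<Omega> f"
  shows "Re (LINT x|lebesgue. f x) \<le> measure lebesgue \<Omega> / 2 ^ CARD('d)"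
proof -
  obtain L where ae: "AE x in lebesgue. \<exists>!l. l \<in> L \<and> x \<in> (\<lambda>y. y + l) ` \<Omega>"
    using \<Omega>(5) unfolding translational_tile_def by blast
  obtain a where a: "0 < a" "\<Omega> \<subseteq> ball 0 a"
    using bounded_subset_ballD[OF \<Omega>(3), of 0] by auto
  have cont: "continuous_on UNIV f" and int: "integrable lebesgue f"
    and ft: "Im (fourier f \<xi>) = 0" "0 \<le> Re (fourier f \<xi>)"
    and supp: "x \<notin> \<Omega> \<Longrightarrow> f x = 0" and f0: "f 0 = 1" for \<xi> x
    using f by (auto simp: turan_admissible_def positive_definite_def supported_in_def)
  have borel: "f \<in> borel_measurable borel" using cont by (rule borel_measurable_continuous_onI)
  have int': "integrable lborel f" using int borel by (simp add: integrable_completion)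
  have "compact (f ` closure \<Omega>)"
    using \<Omega>(3) by (intro compact_continuous_image continuous_on_subset[OF cont]) (auto simp: compact_closure)
  then obtain B where B: "\<And>x. x \<in> closure \<Omega> \<Longrightarrow> norm (f x) \<le> B"
    using compact_imp_bounded bounded_iff by (metis imageI)
  \<comment> \<open>The maximum with \<open>0\<close> serves the points outside \<Omega>, where
    \<open>f\<close> vanishes.\<close>
  have B': "norm (f x) \<le> max B 0" for x
    using B[of x] supp[of x] closure_subset[of \<Omega>] by (cases "x \<in> \<Omega>") auto
  obtain w where w: "\<And>\<xi>. 0 \<le> w \<xi>" "integrable lborel w"
    "\<And>u. f u = (LINT \<xi>|lborel. of_real (w \<xi>) * cis (2 * pi * (\<xi> \<bullet> u)))"
    using continuous_char_inversion[OF cont int' B'] ft unfolding fourier_eq_char_transform[OF borel] by blast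
  define m where "m = measure lebesgue \<Omega>"
  have m: "m > 0"
    using measure_pos_open[OF \<Omega>(1,3,2)] \<Omega>(1) by (simp add: m_def measure_completion)
  define I where "I = Re (LINT x|lborel. f x)"
  define K where "K = (LINT x|lborel. norm (f x))"
  define d where "d = CARD('d)"
  define V where "V = unit_ball_vol (real d)"
  have V: "V > 0" by (simp add: V_def)
  have vol: "measure lborel (ball (0 :: real ^ 'd) s) = V * s ^ d" "measure lebesgue (ball (0 :: real ^ 'd) s) = V * s ^ d" if "s \<ge> 0" for s
    using content_ball[OF that, of "0 :: real ^ 'd"] by (simp_all add: V_def d_def measure_completion)
  \<comment> \<open>The density of the halved translation set: the tiling set has density
    \<open>1 / m\<close>, and halving multiplies it by \<open>2 ^ d\<close>. Accordingly
    \<open>N r\<close> counts halved points of norm below \<open>r\<close>.\<close>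
  define c where "c = 2 ^ d / m"
  have c: "c > 0" using m by (simp add: c_def)
  define N where "N r = card (L \<inter> ball 0 (2 * r))" for r
  have form: "0 \<le> N r - 2 * c * N r * I + c\<^sup>2 * (K * (V * (r + a) ^ d) - (K - I) * (V * r ^ d))" if "r \<ge> 0" for r
  proof -
    let ?D = "(*\<^sub>R) (1/2) ` (L \<inter> ball 0 (2 * r))"
    have "0 \<le> card ?D * Re (f 0) - 2 * c * card ?D * I
      + c\<^sup>2 * (K * measure lborel (ball (0::real^'d) (r + a)) - (K - I) * measure lborel (ball (0::real^'d) r))"
      unfolding I_def K_def
    proof (rule packing_quadratic_form[OF w int'])
      show "norm x < a" if "f x \<noteq> 0" for x using supp[of x] that a by (auto simp: subset_iff)
      show "finite ?D" using finite_translational_tile_ball[OF \<Omega>(1,2) a(2) ae] by simp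
      show "?D \<subseteq> ball 0 r" by auto
      show "f (l - l') = 0" if ll: "l \<in> ?D" "l' \<in> ?D" "l \<noteq> l'" for l l'
      proof -
        obtain k k' where k: "k \<in> L" "k' \<in> L" "l = (1/2) *\<^sub>R k" "l' = (1/2) *\<^sub>R k'" using ll by blast
        then have "(1/2) *\<^sub>R (k - k') \<notin> \<Omega>"
          using ll(3) \<Omega>(4) by (intro translational_tile_half_difference[OF \<Omega>(1) ae]) (auto simp: symmetric_set_def)
        then show ?thesis using supp by (simp add: k scaleR_diff_right)
      qed
    qed (use a in auto)
    moreover have "card ?D = N r" unfolding N_def by (rule card_image) (auto simp: inj_on_def)
    ultimately show ?thesis using that a vol by (simp add: f0)
  qed
  have N_lim: "((\<lambda>r. N r / (V * r ^ d)) \<longlongrightarrow> c) at_top"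
  proof (rule tendsto_sandwich)
    have "((\<lambda>r. (2 + s / r) ^ d / m) \<longlongrightarrow> (2 + 0) ^ d / m) at_top" for s :: real
      by (intro tendsto_intros real_tendsto_divide_at_top[OF tendsto_const] filterlim_ident) (use m in auto)
    then have *: "((\<lambda>r. (2 + s / r) ^ d / m) \<longlongrightarrow> c) at_top" for s :: real by (simp add: c_def)
    show "((\<lambda>r. (2 + (- a) / r) ^ d / m) \<longlongrightarrow> c) at_top" "((\<lambda>r. (2 + a / r) ^ d / m) \<longlongrightarrow> c) at_top"
      by (rule *)+
    \<comment> \<open>For \<open>s = - a\<close> and \<open>s = a\<close> this is the lower and the
      upper counting bound at radius \<open>2 * r\<close>, divided by the volume of the ball of
      radius \<open>r\<close>.\<close>
    have eq: "(2 + s / r) ^ d / m = V * (2 * r + s) ^ d / m / (V * r ^ d)" if "r > 0" for r s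
    proof -
      have "2 + s / r = (2 * r + s) / r" using that by (simp add: field_simps)
      then show ?thesis using that V by (simp add: power_divide)
    qed
    show "\<forall>\<^sub>F r in at_top. (2 + (- a) / r) ^ d / m \<le> N r / (V * r ^ d)"
      using eventually_gt_at_top[of a]
    proof eventually_elim
      case (elim r)
      then have "V * (2 * r - a) ^ d \<le> N r * m"
        using translational_tile_count_ge[OF \<Omega>(1,2) a(2) ae, of "2 * r"] a by (simp add: vol N_def m_def)
      then have "V * (2 * r + - a) ^ d / m \<le> N r" using m by (simp add: pos_divide_le_eq)
      then have "V * (2 * r + - a) ^ d / m / (V * r ^ d) \<le> N r / (V * r ^ d)"
        using elim a V by (intro divide_right_mono) auto
      then show ?case using elim a by (simp only: eq)
    qed
    show "\<forall>\<^sub>F r in at_top. N r / (V * r ^ d) \<le> (2 + a / r) ^ d / m"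
      using eventually_gt_at_top[of a]
    proof eventually_elim
      case (elim r)
      then have "N r * m \<le> V * (2 * r + a) ^ d"
        using translational_tile_count_le[OF \<Omega>(1,2) a(2) ae, of "2 * r"] a by (simp add: vol N_def m_def)
      then have "N r \<le> V * (2 * r + a) ^ d / m" using m by (simp add: pos_le_divide_eq)
      then have "N r / (V * r ^ d) \<le> V * (2 * r + a) ^ d / m / (V * r ^ d)"
        using elim a V by (intro divide_right_mono) auto
      then show ?case using elim a by (simp only: eq)
    qed
  qed
  \<comment> \<open>This is the quadratic form per unit volume. In the limit the shell contributes
    nothing: \<open>(1 + a / r) ^ d\<close> tends to 1, so \<open>K\<close> cancels and
    \<open>c * (1 - c * I)\<close> remains.\<close>
  have "((\<lambda>r. N r / (V * r ^ d) - 2 * c * (N r / (V * r ^ d)) * I + c\<^sup>2 * (K * (1 + a / r) ^ d - (K - I)))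
      \<longlongrightarrow> c - 2 * c * c * I + c\<^sup>2 * (K * (1 + 0) ^ d - (K - I))) at_top"
    by (intro tendsto_intros N_lim real_tendsto_divide_at_top[OF tendsto_const] filterlim_ident)
  moreover have "\<forall>\<^sub>F r in at_top. 0 \<le> N r / (V * r ^ d) - 2 * c * (N r / (V * r ^ d)) * I + c\<^sup>2 * (K * (1 + a / r) ^ d - (K - I))"
    using eventually_gt_at_top[of 0]
  proof eventually_elim
    case (elim r)
    have "1 + a / r = (r + a) / r" using elim by (simp add: field_simps)
    then have "N r / (V * r ^ d) - 2 * c * (N r / (V * r ^ d)) * I + c\<^sup>2 * (K * (1 + a / r) ^ d - (K - I))
      = (N r - 2 * c * N r * I + c\<^sup>2 * (K * (V * (r + a) ^ d) - (K - I) * (V * r ^ d))) / (V * r ^ d)"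
      using elim V by (simp add: power_divide field_simps)
    then show ?case using form[of r] elim V by simp
  qed
  ultimately have "0 \<le> c - 2 * c * c * I + c\<^sup>2 * (K * (1 + 0) ^ d - (K - I))"
    by (rule tendsto_lowerbound) auto
  then have "0 \<le> c * (1 - c * I)" by (simp add: algebra_simps power2_eq_square)
  then have "c * I \<le> 1" using c by (simp add: zero_le_mult_iff)
  then have "I \<le> m / 2 ^ d" using m by (simp add: c_def field_simps)
  then show ?thesis using borel by (simp add: I_def m_def d_def integral_completion)
qed

theorem corollary1:
  fixes \<Omega> :: "(real ^ 'd) set"
  assumes "is_domain \<Omega>"
    and "bounded \<Omega>"
    and "convex \<Omega>"
    and "symmetric_set \<Omega>"
    and "translational_tile \<Omega>"
  shows "turan_domain \<Omega>"
proof -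
  have \<Omega>: "open \<Omega>" "\<Omega> \<noteq> {}" using assms(1) by (auto simp: is_domain_def)
  show ?thesis
    unfolding turan_domain_def
    using assms turan_extremal_admissible[OF \<Omega> assms(2-4)] turan_integral_le[OF \<Omega> assms(2,4,5)]
    by (simp add: integral_turan_extremal[OF \<Omega> assms(2-4)])
qed

end
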